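(* Over the space $\mathcal{D}$, the topology generated by the Hausdorff metric $H$ is strictly finer than the topology generated by the Wasserstein metric $W^\psi$, for every Mulholland function $\psi$.
   Context: Fix $n\ge 2$; $\mathbb{E}^n$ is $n$-dimensional Euclidean space with distance $d$; $v$ is $n$-dimensional volume. A region is a nonempty bounded open subset of $\mathbb{E}^n$ equal to the interior of its closure. $\mathcal{C}$ is the set of convex regions; for regions $X,Y$, $d(X,Y)=\min_{x\in\bar X,y\in\bar Y}d(x,y)$; $\mathcal{D}^2=\{X\cup Y: X,Y\in\mathcal{C},\ d(X,Y)>0\}$; $\mathcal{D}=\mathcal{C}\cup\mathcal{D}^2$. For a point $p$ and region $Q$, $d(p,Q)=\min_{q\in\bar Q}d(p,q)$; $H^1(P,Q)=\sup_{p\in P}d(p,Q)$; the Hausdorff metric is $H(P,Q)=\max(H^1(P,Q),H^1(Q,P))$. Mulholland function: a continuous, (strictly) increasing $\psi:\mathbb{R}^{\ge0}\to\mathbb{R}^{\ge0}$ with $\psi(0)=0$, $\lim_{x\to\infty}\psi(x)=\infty$, and $\psi^{-1}(\sum_{i=1}^m\psi(x_i+y_i))\le\psi^{-1}(\sum_{i=1}^m\psi(x_i))+\psi^{-1}(\sum_{i=1}^m\psi(y_i))$ for all $m$ and all $x_i,y_i\ge0$. Wasserstein metric: for a region $P$ let $U_P$ be the uniform probability distribution on $P$. For regions $P,Q$, $W^\psi(P,Q)=\inf_\gamma\psi^{-1}\left(\frac{1}{v(P)}\int_P\psi(d(x,\gamma(x)))\,dx\right)$, the infimum over all (measurable) functions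 $\gamma$ such that if a random variable $X$ has distribution $U_P$ then $\gamma(X)$ has distribution $U_Q$. *)

theory Defs
  imports "HOL-Analysis.Analysis"
begin

definition region :: "'a::euclidean_space set \<Rightarrow> bool" where
  "region P \<longleftrightarrow> P \<noteq> {} \<and> bounded P \<and> open P \<and> P = interior (closure P)"

definition convex_regions :: "'a::euclidean_space set set" where
  "convex_regions = {P. region P \<and> convex P}"

definition region_dist :: "'a::euclidean_space set \<Rightarrow> 'a set \<Rightarrow> real" where
  "region_dist X Y = setdist (closure X) (closure Y)"

definition two_convex_regions :: "'a::euclidean_space set set" where
  "two_convex_regions =
     {X \<union> Y | X Y. X \<in> convex_regions \<and> Y \<in> convex_regions \<and> region_dist X Y > 0}"

definition region_space :: "'a::euclidean_space set set" where
  "region_space = convex_regions \<union> two_convex_regions"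

definition directed_hausdorff :: "'a::euclidean_space set \<Rightarrow> 'a set \<Rightarrow> real" where
  "directed_hausdorff P Q = (SUP p\<in>P. infdist p (closure Q))"

definition hausdorff :: "'a::euclidean_space set \<Rightarrow> 'a set \<Rightarrow> real" where
  "hausdorff P Q = max (directed_hausdorff P Q) (directed_hausdorff Q P)"

(* A function on the nonnegative reals is represented by a function on the type real of which only
   the values on {0..} matter; its inverse is the inverse of the restriction to {0..}. *)

abbreviation inv_nonneg :: "(real \<Rightarrow> real) \<Rightarrow> real \<Rightarrow> real" where
  "inv_nonneg \<psi> \<equiv> inv_into {0..} \<psi>"

definition mulholland :: "(real \<Rightarrow> real) \<Rightarrow> bool" where
  "mulholland \<psi> \<longleftrightarrow>
     \<psi> \<in> {0..} \<rightarrow> {0..} \<and>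
     continuous_on {0..} \<psi> \<and>
     strict_mono_on {0..} \<psi> \<and>
     \<psi> 0 = 0 \<and>
     filterlim \<psi> at_top at_top \<and>
     (\<forall>(m::nat) x y. (\<forall>i<m. 0 \<le> x i \<and> 0 \<le> y i) \<longrightarrow>
        inv_nonneg \<psi> (\<Sum>i<m. \<psi> (x i + y i))
          \<le> inv_nonneg \<psi> (\<Sum>i<m. \<psi> (x i)) + inv_nonneg \<psi> (\<Sum>i<m. \<psi> (y i)))"

abbreviation uniform_on :: "'a::euclidean_space set \<Rightarrow> 'a measure" where
  "uniform_on P \<equiv> uniform_measure lborel P"

(* Transport maps are Borel functions on the whole space; their values outside P are irrelevant,
   since the complement of P is a null set for the uniform distribution on P. *)

definition transport_maps :: "'a::euclidean_space set \<Rightarrow> 'a set \<Rightarrow> ('a \<Rightarrow> 'a) set" where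
  "transport_maps P Q =
     {\<gamma> \<in> borel_measurable borel. distr (uniform_on P) borel \<gamma> = uniform_on Q}"

(* For regions P and Q, almost every x in P is sent into the bounded set Q, so for a continuous psi
   the integrand is essentially bounded and the Bochner integral below has its intended value. *)

definition wasserstein ::
    "(real \<Rightarrow> real) \<Rightarrow> 'a::euclidean_space set \<Rightarrow> 'a set \<Rightarrow> real" where
  "wasserstein \<psi> P Q =
     (INF \<gamma>\<in>transport_maps P Q.
        inv_nonneg \<psi> (1 / measure lborel P * (LINT x:P|lborel. \<psi> (dist x (\<gamma> x)))))"

(* Metric_space.mtopology is only usable once the metric axioms have been verified.  The same open
   sets form a topology for an arbitrary distance function, and for a metric the two notions agree
   (generated_topology_eq_mtopology below). *)

definition generated_topology :: "'b set \<Rightarrow> ('b \<Rightarrow> 'b \<Rightarrow> real) \<Rightarrow> 'b topology" where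
  "generated_topology M d =
     topology (\<lambda>U. U \<subseteq> M \<and> (\<forall>x\<in>U. \<exists>r>0. {y \<in> M. d x y < r} \<subseteq> U))"

lemma openin_generated_topology:
  "openin (generated_topology M d) U \<longleftrightarrow>
     U \<subseteq> M \<and> (\<forall>x\<in>U. \<exists>r>0. {y \<in> M. d x y < r} \<subseteq> U)"
proof -
  define opn where "opn \<equiv> \<lambda>U. U \<subseteq> M \<and> (\<forall>x\<in>U. \<exists>r>0. {y \<in> M. d x y < r} \<subseteq> U)"
  have "istopology opn"
    unfolding istopology_def
  proof (intro conjI allI impI)
    fix S T assume S: "opn S" and T: "opn T"
    show "opn (S \<inter> T)"
      unfolding opn_def
    proof (intro conjI ballI)
      show "S \<inter> T \<subseteq> M" using S by (auto simp: opn_def)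
      fix x assume "x \<in> S \<inter> T"
      then have xS: "x \<in> S" and xT: "x \<in> T" by auto
      obtain r where "r > 0" "{y \<in> M. d x y < r} \<subseteq> S"
        using S xS unfolding opn_def by blast
      moreover obtain s where "s > 0" "{y \<in> M. d x y < s} \<subseteq> T"
        using T xT unfolding opn_def by blast
      ultimately show "\<exists>r>0. {y \<in> M. d x y < r} \<subseteq> S \<inter> T"
        by (intro exI[of _ "min r s"]) auto
    qed
  next
    fix K assume K: "\<forall>S\<in>K. opn S"
    show "opn (\<Union>K)"
      unfolding opn_def
    proof (intro conjI ballI)
      show "\<Union>K \<subseteq> M" using K by (auto simp: opn_def)
      fix x assume "x \<in> \<Union>K"
      then obtain S where S: "S \<in> K" "x \<in> S" by blast
      then obtain r where "r > 0" "{y \<in> M. d x y < r} \<subseteq> S"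
        using K unfolding opn_def by blast
      then show "\<exists>r>0. {y \<in> M. d x y < r} \<subseteq> \<Union>K" using S by blast
    qed
  qed
  then show ?thesis
    by (simp add: generated_topology_def opn_def)
qed

lemma generated_topology_eq_mtopology:
  assumes "Metric_space M d"
  shows "generated_topology M d = Metric_space.mtopology M d"
proof -
  interpret Metric_space M d by fact
  have "mball x r = {y \<in> M. d x y < r}" if "x \<in> M" for x r
    using that by auto
  then show ?thesis
    unfolding topology_eq openin_generated_topology openin_mtopology
    by (metis subsetD)
qed

definition strictly_finer :: "'b topology \<Rightarrow> 'b topology \<Rightarrow> bool" where
  "strictly_finer S T \<longleftrightarrow> {U. openin T U} \<subset> {U. openin S U}"

end

theory Submission
  imports Defs
begin

text \<open>
  Both halves rest on one estimate: for a fixed \<open>P\<close>, the distance \<open>W P Q\<close> is small as soon as the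
  symmetric difference of \<open>P\<close> and \<open>Q\<close> has small volume. A transport map is obtained by first scaling
  \<open>P\<close> to the volume of \<open>Q\<close>, which moves every point only a little, then keeping the common part of
  the scaled set \<open>L\<close> and \<open>Q\<close> fixed and mapping \<open>L - Q\<close> onto \<open>Q - L\<close>, of equal volume, by a countable
  piecewise translation. The latter is built greedily: at each step one translates a part of what is
  left whose volume is at least half of the best possible; by Tonelli nothing but null sets remains.

  If \<open>Q\<close> is Hausdorff close to \<open>P\<close>, then \<open>Q - P\<close> lies near the null set \<open>frontier P\<close>. A point deep
  inside \<open>P\<close> that is not in \<open>closure Q\<close> must lie in a thin slab around a hyperplane separating the two
  convex pieces of \<open>Q\<close>, so \<open>P - Q\<close> is small as well. Conversely, adding a tiny distant ball
  to the unit ball is a small change for \<open>W\<close> but not for \<open>H\<close>.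
\<close>

section \<open>Measure-preserving maps by piecewise translation\<close>

lemma vimage_borel:
  fixes f :: "'a::topological_space \<Rightarrow> 'b::topological_space"
  shows "f \<in> borel_measurable borel \<Longrightarrow> S \<in> sets borel \<Longrightarrow> f -` S \<in> sets borel"
  using measurable_sets[of f borel borel S] by simp

text \<open>By Tonelli and translation invariance, integrating the volume of the overlap over all
  \<open>t\<close> gives the product of the volumes of \<open>A\<close> and \<open>B\<close>. If
  every overlap is null, this product is 0.\<close>

lemma null_if_overlaps_null:
  fixes A B :: "'a::euclidean_space set"
  assumes [measurable]: "A \<in> sets borel" "B \<in> sets borel"
    and ov: "\<And>t. emeasure lborel (A \<inter> (\<lambda>x. x + t) -` B) = 0"
  shows "emeasure lborel A = 0 \<or> emeasure lborel B = 0"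
proof -
  have shift: "(\<integral>\<^sup>+ t. indicator B (x + t) \<partial>lborel) = emeasure lborel B" for x :: 'a
  proof -
    have "emeasure lborel B = (\<integral>\<^sup>+ t. indicator B t \<partial>distr lborel borel ((+) x))"
      by (simp add: lborel_distr_plus)
    then show ?thesis by (subst (asm) nn_integral_distr) auto
  qed
  have "0 = (\<integral>\<^sup>+ t. emeasure lborel (A \<inter> (\<lambda>x. x + t) -` B) \<partial>lborel)"
    by (simp add: ov)
  also have "\<dots> = (\<integral>\<^sup>+ t. (\<integral>\<^sup>+ x. indicator A x * indicator B (x + t) \<partial>lborel) \<partial>lborel)"
  proof (rule nn_integral_cong)
    fix t :: 'a
    have m: "A \<inter> (\<lambda>x. x + t) -` B \<in> sets lborel"
      using vimage_borel[of "\<lambda>x. x + t" B] assms by auto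
    have "emeasure lborel (A \<inter> (\<lambda>x. x + t) -` B)
        = (\<integral>\<^sup>+ x. indicator (A \<inter> (\<lambda>x. x + t) -` B) x \<partial>lborel)"
      using m by simp
    also have "\<dots> = (\<integral>\<^sup>+ x. indicator A x * indicator B (x + t) \<partial>lborel)"
      by (rule nn_integral_cong) (auto simp: indicator_def)
    finally show "emeasure lborel (A \<inter> (\<lambda>x. x + t) -` B)
        = (\<integral>\<^sup>+ x. indicator A x * indicator B (x + t) \<partial>lborel)" .
  qed
  also have "\<dots> = (\<integral>\<^sup>+ x. (\<integral>\<^sup>+ t. indicator A x * indicator B (x + t) \<partial>lborel) \<partial>lborel)"
    by (rule lborel_pair.Fubini') measurable
  also have "\<dots> = (\<integral>\<^sup>+ x. indicator A x * emeasure lborel B \<partial>lborel)"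
    by (simp add: nn_integral_cmult shift)
  also have "\<dots> = emeasure lborel A * emeasure lborel B"
    by (simp add: nn_integral_multc)
  finally show ?thesis by auto
qed

lemma exists_measure_preserving_map:
  fixes A B :: "'a::euclidean_space set"
  assumes A: "A \<in> sets borel" and B: "B \<in> sets borel"
    and fin: "emeasure lborel A < \<infinity>"
    and eq: "emeasure lborel A = emeasure lborel B"
  obtains T where "T \<in> borel_measurable borel" "\<And>x. T x \<in> insert c B"
    "\<And>S. S \<in> sets borel \<Longrightarrow> emeasure lborel (A \<inter> T -` S) = emeasure lborel (B \<inter> S)"
proof -
  \<comment> \<open>\<open>C\<close> is the part of \<open>A\<close> that the translation by
    \<open>t\<close> carries into \<open>B\<close>, and \<open>D\<close> is its image. Both have the
    same volume, so removing them keeps the two leftovers equal in volume.\<close>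
  define C where "C = (\<lambda>(A::'a set) B t. A \<inter> (\<lambda>x. x + t) -` B)"
  define D where "D = (\<lambda>(A::'a set) B t. B \<inter> (\<lambda>x. x - t) -` A)"
  define ok where "ok = (\<lambda>M::'a set. M \<in> sets borel \<and> emeasure lborel M < \<infinity>)"
  have C_borel: "C A' B' t \<in> sets borel" if "A' \<in> sets borel" "B' \<in> sets borel" for A' B' t
    using vimage_borel[of "\<lambda>x. x + t" B'] that unfolding C_def by auto
  have D_borel: "D A' B' t \<in> sets borel" if "A' \<in> sets borel" "B' \<in> sets borel" for A' B' t
    using vimage_borel[of "\<lambda>x. x - t" A'] that unfolding D_def by auto
  have CD: "emeasure lborel (C A' B' t \<inter> (\<lambda>x. x + t) -` S) = emeasure lborel (D A' B' t \<inter> S)"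
    if "A' \<in> sets borel" "B' \<in> sets borel" "S \<in> sets borel" for A' B' t S
  proof -
    have "emeasure lborel (D A' B' t \<inter> S) = emeasure (distr lborel borel ((+) t)) (D A' B' t \<inter> S)"
      by (simp add: lborel_distr_plus)
    also have "\<dots> = emeasure lborel ((+) t -` (D A' B' t \<inter> S))"
      using D_borel that by (subst emeasure_distr) auto
    also have "(+) t -` (D A' B' t \<inter> S) = C A' B' t \<inter> (\<lambda>x. x + t) -` S"
      by (auto simp: C_def D_def add.commute)
    finally show ?thesis by simp
  qed
  have ok_mono: "ok M" if "ok M'" "M \<subseteq> M'" "M \<in> sets borel" for M M'
    using that emeasure_mono[of M M' lborel] unfolding ok_def by auto
  \<comment> \<open>Asking only for half of the supremum avoids having to show that it is attained.
    If the supremum is 0, any \<open>t\<close> will do.\<close>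
  have "\<exists>t. \<forall>s. measure lborel (C A' B' s) \<le> 2 * measure lborel (C A' B' t)" if "ok A'" "ok B'" for A' B'
  proof -
    define m where "m = (SUP s. measure lborel (C A' B' s))"
    have bdd: "bdd_above (range (\<lambda>s. measure lborel (C A' B' s)))"
    proof (rule bdd_aboveI2)
      fix s show "measure lborel (C A' B' s) \<le> measure lborel A'"
        using that C_borel by (intro measure_mono_fmeasurable) (auto simp: ok_def fmeasurable_def C_def)
    qed
    have le: "measure lborel (C A' B' s) \<le> m" for s
      unfolding m_def by (rule cSUP_upper[OF _ bdd]) auto
    show ?thesis
    proof (cases "m \<le> 0")
      case True
      then show ?thesis
        using le by (intro exI[of _ 0] allI) (smt (verit) measure_nonneg)
    next
      case False
      then have "m / 2 < (SUP s. measure lborel (C A' B' s))" by (simp add: m_def[symmetric])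
      then obtain t where "m / 2 < measure lborel (C A' B' t)"
        unfolding less_cSUP_iff[OF UNIV_not_empty bdd] by blast
      then show ?thesis using le by (intro exI[of _ t] allI) (smt (verit) field_sum_of_halves)
    qed
  qed
  then obtain pick where pick: "\<And>A' B' s. ok A' \<Longrightarrow> ok B' \<Longrightarrow>
      measure lborel (C A' B' s) \<le> 2 * measure lborel (C A' B' (pick A' B'))"
    by metis
  \<comment> \<open>The state is the pair of leftovers of \<open>A\<close> and \<open>B\<close>;
    each step cuts one matched piece off both.\<close>
  define st where "st = rec_nat (A, B) (\<lambda>_ (A, B). (A - C A B (pick A B), B - D A B (pick A B)))"
  define a where "a k = fst (st k)" for k
  define b where "b k = snd (st k)" for k
  define t where "t k = pick (a k) (b k)" for k
  define c' where "c' k = C (a k) (b k) (t k)" for k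
  define d' where "d' k = D (a k) (b k) (t k)" for k
  have a0: "a 0 = A" and b0: "b 0 = B" by (simp_all add: a_def b_def st_def)
  have aS: "a (Suc k) = a k - c' k" and bS: "b (Suc k) = b k - d' k" for k
    by (simp_all add: a_def b_def st_def c'_def d'_def t_def split: prod.splits)
  have okA: "ok A" and okB: "ok B" using A B fin eq by (simp_all add: ok_def)
  have borel: "a k \<in> sets borel \<and> b k \<in> sets borel" for k
    by (induction k) (auto simp: a0 b0 aS bS c'_def d'_def A B C_borel D_borel)
  have cb: "c' k \<in> sets borel" and db: "d' k \<in> sets borel" for k
    using borel by (auto simp: c'_def d'_def C_borel D_borel)
  have ca: "c' k \<subseteq> a k" and dbs: "d' k \<subseteq> b k" for k by (auto simp: c'_def d'_def C_def D_def)
  have amono: "a j \<subseteq> a i" if "i \<le> j" for i j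
    using that by (induction rule: dec_induct) (auto simp: aS)
  have bmono: "b j \<subseteq> b i" if "i \<le> j" for i j
    using that by (induction rule: dec_induct) (auto simp: bS)
  have dc: "disjoint_family c'"
    unfolding disjoint_family_on_def
  proof (intro ballI impI)
    have *: "c' i \<inter> c' j = {}" if "i < j" for i j
      using amono[of "Suc i" j] ca[of j] that by (auto simp: aS)
    fix m n :: nat assume "m \<noteq> n" then show "c' m \<inter> c' n = {}" using *[of m n] *[of n m] by (cases "m < n") auto
  qed
  have dd: "disjoint_family d'"
    unfolding disjoint_family_on_def
  proof (intro ballI impI)
    have *: "d' i \<inter> d' j = {}" if "i < j" for i j
      using bmono[of "Suc i" j] dbs[of j] that by (auto simp: bS)
    fix m n :: nat assume "m \<noteq> n" then show "d' m \<inter> d' n = {}" using *[of m n] *[of n m] by (cases "m < n") auto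
  qed
  define A' where "A' = A - (\<Union>k. c' k)"
  define B' where "B' = B - (\<Union>k. d' k)"
  have A'b: "A' \<in> sets borel" and B'b: "B' \<in> sets borel" using A B cb db by (auto simp: A'_def B'_def)
  have UcA: "(\<Union>k. c' k) \<subseteq> A" and UdB: "(\<Union>k. d' k) \<subseteq> B"
    using ca dbs amono[of 0] bmono[of 0] by (fastforce simp: a0 b0)+
  have A'a: "A' \<subseteq> a k" for k by (induction k) (auto simp: a0 aS A'_def)
  have B'b': "B' \<subseteq> b k" for k by (induction k) (auto simp: b0 bS B'_def)
  have ecd: "emeasure lborel (c' k) = emeasure lborel (d' k)" for k
    using CD[of "a k" "b k" UNIV "t k"] borel by (simp add: c'_def d'_def)
  have eU: "emeasure lborel (\<Union>k. c' k) = emeasure lborel (\<Union>k. d' k)"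
    using suminf_emeasure[of c' lborel] suminf_emeasure[of d' lborel] cb db dc dd ecd by (auto simp: image_subset_iff)
  have finU: "emeasure lborel (\<Union>k. c' k) < \<infinity>"
    using fin emeasure_mono[OF UcA, of lborel] A by auto
  have eq': "emeasure lborel A' = emeasure lborel B'"
    unfolding A'_def B'_def using finU eU eq UcA UdB cb db A B
    by (subst (1 2) emeasure_Diff) auto
  \<comment> \<open>The pieces are disjoint subsets of \<open>A\<close>, whose volume is finite, so
    their volumes are summable.\<close>
  have lim: "(\<lambda>k. measure lborel (c' k)) \<longlonglongrightarrow> 0"
  proof (rule summable_LIMSEQ_zero)
    show "summable (\<lambda>k. measure lborel (c' k))"
      by (rule sums_summable[OF measure_UNION]) (use cb dc finU in auto)
  qed
  have okA': "ok A'" using ok_mono[OF okA] A'b by (auto simp: A'_def)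
  \<comment> \<open>\<open>A'\<close> and \<open>B'\<close> lie in the leftovers of every stage, so
    the greedy choice bounds any of their overlaps by twice the volume of the \<open>k\<close>-th
    piece, for every \<open>k\<close>.\<close>
  have "emeasure lborel (A' \<inter> (\<lambda>x. x + s) -` B') = 0" for s
  proof -
    have "measure lborel (C A' B' s) \<le> 2 * measure lborel (c' k)" for k
    proof -
      have ok: "ok (a k)" "ok (b k)" using ok_mono[OF okA] ok_mono[OF okB] amono[of 0 k] bmono[of 0 k] borel[of k]
        by (auto simp: a0 b0)
      have "measure lborel (C A' B' s) \<le> measure lborel (C (a k) (b k) s)"
        using C_borel A'b B'b borel[of k] A'a[of k] B'b'[of k] ok_mono[OF ok(1), of "C (a k) (b k) s"]
        by (intro measure_mono_fmeasurable) (auto simp: fmeasurable_def C_def ok_def)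
      also have "\<dots> \<le> 2 * measure lborel (c' k)"
        unfolding c'_def t_def by (rule pick[OF ok])
      finally show ?thesis .
    qed
    moreover have "(\<lambda>k. 2 * measure lborel (c' k)) \<longlonglongrightarrow> 0"
      using tendsto_mult_right_zero[OF lim] by simp
    ultimately have "measure lborel (C A' B' s) \<le> 0"
      using LIMSEQ_le_const by blast
    then have "measure lborel (C A' B' s) = 0" by (simp add: antisym)
    moreover have "ok (C A' B' s)" using ok_mono[OF okA'] C_borel[OF A'b B'b] by (auto simp: C_def)
    ultimately show ?thesis
      by (simp add: ok_def measure_eq_emeasure_eq_ennreal emeasure_eq_ennreal_measure C_def less_top)
  qed
  then have null: "emeasure lborel A' = 0" "emeasure lborel B' = 0"
    using null_if_overlaps_null[OF A'b B'b] eq' by auto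
  \<comment> \<open>With the index \<open>N x\<close> of the piece containing \<open>x\<close>,
    measurability of \<open>T\<close> reduces to that of countably many translations.\<close>
  define N where "N x = (LEAST k. x \<in> c' k)" for x
  define T where "T x = (if \<exists>k. x \<in> c' k then x + t (N x) else c)" for x
  have Nc: "N x = k" if "x \<in> c' k" for x k
  proof -
    have "x \<in> c' (N x)" unfolding N_def using that by (rule LeastI)
    then show ?thesis using dc that unfolding disjoint_family_on_def by blast
  qed
  have Tc: "T x = x + t k" if "x \<in> c' k" for x k
    using that Nc[OF that] by (auto simp: T_def)
  have [measurable]: "Measurable.pred borel (\<lambda>x. x \<in> c' k)" for k using cb by simp
  have [measurable]: "N \<in> borel \<rightarrow>\<^sub>M count_space UNIV" unfolding N_def by measurable
  have [measurable]: "(\<lambda>x. x + t (N x)) \<in> borel_measurable borel"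
    by (rule measurable_compose_countable[of "\<lambda>k x. x + t k" _ _ N]) measurable
  have Tm: "T \<in> borel_measurable borel" unfolding T_def by measurable
  have TB: "T x \<in> insert c B" for x
  proof (cases "\<exists>k. x \<in> c' k")
    case True
    then obtain k where "x \<in> c' k" by blast
    then have "x + t k \<in> b k" by (auto simp: c'_def C_def)
    with bmono[of 0 k] Tc[OF \<open>x \<in> c' k\<close>] show ?thesis by (auto simp: b0)
  qed (simp add: T_def)
  have main: "emeasure lborel (A \<inter> T -` S) = emeasure lborel (B \<inter> S)" if S: "S \<in> sets borel" for S
  proof -
    have TS: "T -` S \<in> sets borel" using vimage_borel[OF Tm S] .
    \<comment> \<open>Adjoining the null set \<open>A'\<close> absorbs the points of
      \<open>A\<close> where \<open>T\<close> takes the default value \<open>c\<close>, so that the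
      set identity below is exact.\<close>
    have "emeasure lborel (A \<inter> T -` S) = emeasure lborel ((A \<inter> T -` S) \<union> A')"
      using null A'b A TS by (subst emeasure_Un_null_set) (auto simp: null_sets_def)
    also have "(A \<inter> T -` S) \<union> A' = (\<Union>k. c' k \<inter> T -` S) \<union> A'" using UcA by (auto simp: A'_def)
    also have "emeasure lborel \<dots> = emeasure lborel (\<Union>k. c' k \<inter> T -` S)"
      using null A'b cb TS by (subst emeasure_Un_null_set) (auto simp: null_sets_def)
    also have "\<dots> = (\<Sum>k. emeasure lborel (c' k \<inter> T -` S))"
      using cb TS dc by (intro suminf_emeasure[symmetric]) (auto simp: disjoint_family_on_def)
    also have "\<dots> = (\<Sum>k. emeasure lborel (d' k \<inter> S))"
    proof (rule suminf_cong)
      fix k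
      have "c' k \<inter> T -` S = c' k \<inter> (\<lambda>x. x + t k) -` S" using Tc by auto
      then show "emeasure lborel (c' k \<inter> T -` S) = emeasure lborel (d' k \<inter> S)"
        using CD[of "a k" "b k" S "t k"] borel S by (simp add: c'_def d'_def)
    qed
    also have "\<dots> = emeasure lborel (\<Union>k. d' k \<inter> S)"
      using db S dd by (intro suminf_emeasure) (auto simp: disjoint_family_on_def)
    also have "\<dots> = emeasure lborel ((\<Union>k. d' k \<inter> S) \<union> B')"
      using null B'b db S by (subst emeasure_Un_null_set) (auto simp: null_sets_def)
    also have "(\<Union>k. d' k \<inter> S) \<union> B' = (B \<inter> S) \<union> B'" using UdB by (auto simp: B'_def)
    also have "emeasure lborel \<dots> = emeasure lborel (B \<inter> S)"
      using null B'b B S by (subst emeasure_Un_null_set) (auto simp: null_sets_def)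
    finally show ?thesis .
  qed
  show thesis using that[OF Tm TB main] .
qed

section \<open>Mulholland functions and the cost of a transport map\<close>

lemma measure_open_pos:
  fixes P :: "'a::euclidean_space set"
  assumes "open P" "P \<noteq> {}" "bounded P"
  shows "0 < measure lborel P"
proof (rule ccontr)
  assume "\<not> 0 < measure lborel P"
  then have "emeasure lborel P = 0"
    using emeasure_bounded_finite[OF \<open>bounded P\<close>] measure_nonneg[of lborel P]
      emeasure_eq_ennreal_measure[of lborel P] by auto
  then have "P \<in> null_sets lebesgue"
    using assms by (intro null_sets_completionI null_setsI) auto
  then show False using open_not_negligible[of P] assms by (simp add: negligible_iff_null_sets)
qed

lemma mulholland_mono:
  assumes "mulholland \<psi>" "0 \<le> x" "x \<le> y" shows "\<psi> x \<le> \<psi> y"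
  using assms strict_mono_on_leD[of "{0..}" \<psi> x y] unfolding mulholland_def by auto

lemma mulholland_nonneg:
  assumes "mulholland \<psi>" "0 \<le> x" shows "0 \<le> \<psi> x"
  using assms unfolding mulholland_def by auto

text \<open>Unboundedness and the intermediate value theorem make \<open>\<psi>\<close> map onto the
  nonnegative reals, so \<open>inv_nonneg\<close> is a true inverse there and not an arbitrary
  choice.\<close>

lemma mulholland_inverse:
  assumes \<psi>: "mulholland \<psi>" and y: "0 \<le> y"
  shows "0 \<le> inv_nonneg \<psi> y" "\<psi> (inv_nonneg \<psi> y) = y"
proof -
  have "filterlim \<psi> at_top at_top" using \<psi> by (simp add: mulholland_def)
  then have "eventually (\<lambda>x. y \<le> \<psi> x) at_top" by (simp add: filterlim_at_top)
  then obtain b where b: "\<And>x. b \<le> x \<Longrightarrow> y \<le> \<psi> x" by (auto simp: eventually_at_top_linorder)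
  have "\<exists>x\<ge>0. x \<le> max b 0 \<and> \<psi> x = y"
  proof (rule IVT')
    show "\<psi> 0 \<le> y" "y \<le> \<psi> (max b 0)" using \<psi> y b by (auto simp: mulholland_def)
    show "continuous_on {0..max b 0} \<psi>"
      using \<psi> by (auto simp: mulholland_def intro: continuous_on_subset)
  qed auto
  then have "y \<in> \<psi> ` {0..}" by auto
  then show "0 \<le> inv_nonneg \<psi> y" "\<psi> (inv_nonneg \<psi> y) = y"
    using inv_into_into[of y \<psi> "{0..}"] f_inv_into_f[of y \<psi> "{0..}"] by auto
qed

lemma inv_nonneg_less:
  assumes \<psi>: "mulholland \<psi>" and "0 \<le> y" "y < \<psi> \<epsilon>" "0 \<le> \<epsilon>"
  shows "inv_nonneg \<psi> y < \<epsilon>"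
  using mulholland_inverse[OF \<psi> \<open>0 \<le> y\<close>] mulholland_mono[OF \<psi> \<open>0 \<le> \<epsilon>\<close>, of "inv_nonneg \<psi> y"] assms
  by (smt (verit))

text \<open>All costs are nonnegative, so the infimum is taken over a set bounded below and one good
  transport map bounds it. Comparing the mean cost with \<open>\<psi> \<epsilon>\<close> means that
  later estimates never have to handle the inverse of a sum.\<close>

lemma wasserstein_less:
  assumes \<psi>: "mulholland \<psi>" and "0 \<le> \<epsilon>" "\<gamma> \<in> transport_maps P Q"
    and "1 / measure lborel P * (LINT x:P|lborel. \<psi> (dist x (\<gamma> x))) < \<psi> \<epsilon>"
  shows "wasserstein \<psi> P Q < \<epsilon>"
proof -
  define cost where "cost \<gamma> = 1 / measure lborel P * (LINT x:P|lborel. \<psi> (dist x (\<gamma> x)))" for \<gamma>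
  have nonneg: "0 \<le> cost \<gamma>" for \<gamma>
    unfolding cost_def set_lebesgue_integral_def
    by (intro mult_nonneg_nonneg integral_nonneg_AE AE_I2)
      (auto simp: indicator_def mulholland_nonneg[OF \<psi>])
  have "wasserstein \<psi> P Q \<le> inv_nonneg \<psi> (cost \<gamma>)"
    unfolding wasserstein_def cost_def[symmetric]
    using assms mulholland_inverse(1)[OF \<psi> nonneg]
    by (intro cINF_lower bdd_belowI2[of _ 0]) auto
  also have "\<dots> < \<epsilon>"
    using inv_nonneg_less[OF \<psi> nonneg] assms by (simp add: cost_def)
  finally show ?thesis .
qed

section \<open>Transport by scaling and rearranging\<close>

text \<open>Change of variables for a homothety, in preimage form because image distributions are
  computed from preimages.\<close>

lemma emeasure_lborel_scaleR_vimage: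
  fixes S :: "'a::euclidean_space set"
  assumes S: "S \<in> sets borel" and c: "c \<noteq> 0"
  shows "emeasure lborel S = ennreal (\<bar>c\<bar> ^ DIM('a)) * emeasure lborel ((\<lambda>x. c *\<^sub>R x) -` S)"
proof -
  have "emeasure lborel S = emeasure (density (distr lborel borel (\<lambda>x::'a. 0 + c *\<^sub>R x)) (\<lambda>_. \<bar>c\<bar> ^ DIM('a))) S"
    using lborel_affine[OF c, of "0::'a"] by simp
  also have "\<dots> = ennreal (\<bar>c\<bar> ^ DIM('a)) * emeasure (distr lborel borel (\<lambda>x::'a. c *\<^sub>R x)) S"
    using S by (simp add: emeasure_density nn_integral_cmult)
  also have "emeasure (distr lborel borel (\<lambda>x::'a. c *\<^sub>R x)) S = emeasure lborel ((\<lambda>x. c *\<^sub>R x) -` S)"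
    using S by (subst emeasure_distr) auto
  finally show ?thesis .
qed

text \<open>The homothety by \<open>l\<close> carries the uniform distribution on \<open>P\<close>
  to that on \<open>L\<close>, a set with the volume of \<open>Q\<close>; afterwards
  \<open>G\<close> moves only \<open>L - Q\<close>. The bound \<open>2 * R\<close> is the diameter
  of the common ball.\<close>

lemma scaled_transport:
  fixes P Q :: "'a::euclidean_space set"
  assumes P: "open P" "P \<noteq> {}" "P \<subseteq> ball 0 R" and Q: "open Q" "Q \<noteq> {}" "Q \<subseteq> ball 0 R"
    and l: "l > 0" "l ^ DIM('a) * measure lborel P = measure lborel Q"
  obtains \<gamma> where "\<gamma> \<in> transport_maps P Q"
    "\<And>x. x \<in> P \<Longrightarrow> dist x (\<gamma> x) \<le> 2 * R"
    "\<And>x. x \<in> P \<Longrightarrow> l *\<^sub>R x \<in> Q \<Longrightarrow> \<gamma> x = l *\<^sub>R x"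
proof -
  define L where "L = (\<lambda>x. inverse l *\<^sub>R x) -` P"
  have [measurable]: "P \<in> sets borel" "Q \<in> sets borel" using P Q by auto
  have Lb [measurable]: "L \<in> sets borel" unfolding L_def by (rule vimage_borel) auto
  have lL: "(\<lambda>x. l *\<^sub>R x) -` L = P" using l by (auto simp: L_def)
  have finP: "emeasure lborel P < \<infinity>" and finQ: "emeasure lborel Q < \<infinity>"
    using emeasure_bounded_finite[OF bounded_subset[OF bounded_ball P(3)]]
      emeasure_bounded_finite[OF bounded_subset[OF bounded_ball Q(3)]] by auto
  have eP: "emeasure lborel P = ennreal (measure lborel P)"
    and eQ: "emeasure lborel Q = ennreal (measure lborel Q)"
    using finP finQ by (auto simp: emeasure_eq_ennreal_measure)
  have eL: "emeasure lborel L = emeasure lborel Q"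
    using emeasure_lborel_scaleR_vimage[of L l] l
    by (simp add: lL eP eQ ennreal_mult'[symmetric])
  \<comment> \<open>This default value lies in \<open>Q\<close>, so the final map has all its values
    in \<open>Q\<close>, even off the translated pieces.\<close>
  obtain q where q: "q \<in> Q" using Q by auto
  have "emeasure lborel (L \<inter> Q) < \<infinity>"
    using finQ emeasure_mono[of "L \<inter> Q" Q lborel] by auto
  then have "emeasure lborel (L - L \<inter> Q) = emeasure lborel (Q - L \<inter> Q)"
    using eL by (simp add: emeasure_Diff)
  moreover have "L - L \<inter> Q = L - Q" "Q - L \<inter> Q = Q - L" by auto
  ultimately have "emeasure lborel (L - Q) = emeasure lborel (Q - L)" by simp
  moreover have "emeasure lborel (L - Q) < \<infinity>"
    using finQ eL emeasure_mono[of "L - Q" L lborel] by auto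
  ultimately obtain T where T [measurable]: "T \<in> borel_measurable borel"
    and TQ: "\<And>x. T x \<in> insert q (Q - L)"
    and Tm: "\<And>S. S \<in> sets borel \<Longrightarrow>
      emeasure lborel ((L - Q) \<inter> T -` S) = emeasure lborel ((Q - L) \<inter> S)"
    using exists_measure_preserving_map[of "L - Q" "Q - L" q] by auto
  define G where "G y = (if y \<in> Q then y else T y)" for y
  have [measurable]: "G \<in> borel_measurable borel" unfolding G_def by measurable
  have GQ: "G y \<in> Q" for y using TQ[of y] q by (auto simp: G_def)
  define \<gamma> where "\<gamma> x = G (l *\<^sub>R x)" for x
  have \<gamma>m [measurable]: "\<gamma> \<in> borel_measurable borel" unfolding \<gamma>_def by measurable
  have "distr (uniform_on P) borel \<gamma> = uniform_on Q"
  proof (rule measure_eqI)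
    fix S assume "S \<in> sets (distr (uniform_on P) borel \<gamma>)"
    then have S [measurable]: "S \<in> sets borel" by simp
    have GS [measurable]: "G -` S \<in> sets borel" "T -` S \<in> sets borel" "\<gamma> -` S \<in> sets borel"
      by (rule vimage_borel; simp)+
    \<comment> \<open>\<open>Q \<inter> S\<close> splits into a part fixed by \<open>G\<close> and a
      part filled by \<open>T\<close>. Pulling both back, first through \<open>G\<close> and then
      through the homothety, yields the preimage under \<open>\<gamma>\<close> up to the factor
      \<open>l ^ DIM('a)\<close>.\<close>
    have "emeasure lborel (Q \<inter> S) = emeasure lborel ((L \<inter> Q \<inter> S) \<union> ((Q - L) \<inter> S))"
      by (rule arg_cong[where f = "emeasure lborel"]) auto
    also have "\<dots> = emeasure lborel (L \<inter> Q \<inter> S) + emeasure lborel ((Q - L) \<inter> S)"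
      by (rule plus_emeasure[symmetric]) auto
    also have "\<dots> = emeasure lborel (L \<inter> Q \<inter> S) + emeasure lborel ((L - Q) \<inter> T -` S)"
      by (simp add: Tm)
    also have "\<dots> = emeasure lborel ((L \<inter> Q \<inter> S) \<union> ((L - Q) \<inter> T -` S))"
      by (rule plus_emeasure) auto
    also have "(L \<inter> Q \<inter> S) \<union> ((L - Q) \<inter> T -` S) = L \<inter> G -` S"
      by (auto simp: G_def split: if_splits)
    also have "emeasure lborel (L \<inter> G -` S) = ennreal (l ^ DIM('a)) * emeasure lborel ((\<lambda>x. l *\<^sub>R x) -` (L \<inter> G -` S))"
      using emeasure_lborel_scaleR_vimage[of "L \<inter> G -` S" l] l by simp
    also have "(\<lambda>x. l *\<^sub>R x) -` (L \<inter> G -` S) = P \<inter> \<gamma> -` S"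
      using lL by (auto simp: \<gamma>_def)
    finally have QS: "emeasure lborel (Q \<inter> S) = ennreal (l ^ DIM('a)) * emeasure lborel (P \<inter> \<gamma> -` S)" .
    have "emeasure (distr (uniform_on P) borel \<gamma>) S = emeasure lborel (P \<inter> \<gamma> -` S) / emeasure lborel P"
      by (subst emeasure_distr) auto
    also have "\<dots> = emeasure lborel (Q \<inter> S) / emeasure lborel Q"
    proof -
      have "emeasure lborel Q = ennreal (l ^ DIM('a)) * emeasure lborel P"
        using l by (simp add: eP eQ ennreal_mult'[symmetric])
      then show ?thesis
        using divide_mult_eq[of "ennreal (l ^ DIM('a))"] l unfolding QS
        by (simp add: mult.commute[of "ennreal (l ^ DIM('a))"])
    qed
    finally show "emeasure (distr (uniform_on P) borel \<gamma>) S = emeasure (uniform_on Q) S" by simp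
  qed simp
  then have "\<gamma> \<in> transport_maps P Q" by (simp add: transport_maps_def)
  moreover have "dist x (\<gamma> x) \<le> 2 * R" if "x \<in> P" for x
  proof -
    have "norm x < R" "norm (\<gamma> x) < R" using that GQ[of "l *\<^sub>R x"] P Q by (auto simp: \<gamma>_def)
    then show ?thesis using norm_triangle_ineq4[of x "\<gamma> x"] by (simp add: dist_norm)
  qed
  moreover have "\<gamma> x = l *\<^sub>R x" if "l *\<^sub>R x \<in> Q" for x using that by (simp add: \<gamma>_def G_def)
  ultimately show thesis by (rule that)
qed

text \<open>A point of \<open>P\<close> scaled into \<open>Q\<close> moves by at most
  \<open>\<bar>1 - l\<bar> * R\<close>, and any other point of \<open>P\<close> by at most
  \<open>2 * R\<close>. The two summands are the corresponding contributions to the mean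
  cost.\<close>

lemma wasserstein_less_scaled:
  fixes P Q :: "'a::euclidean_space set"
  assumes \<psi>: "mulholland \<psi>" and \<epsilon>: "0 \<le> \<epsilon>"
    and P: "open P" "P \<noteq> {}" "P \<subseteq> ball 0 R" and Q: "open Q" "Q \<noteq> {}" "Q \<subseteq> ball 0 R"
    and l: "l > 0" "l ^ DIM('a) * measure lborel P = measure lborel Q"
    and small: "\<psi> (\<bar>1 - l\<bar> * R)
      + \<psi> (2 * R) * measure lborel ((\<lambda>x. l *\<^sub>R x) ` P - Q) / measure lborel Q < \<psi> \<epsilon>"
  shows "wasserstein \<psi> P Q < \<epsilon>"
proof -
  obtain \<gamma> where \<gamma>: "\<gamma> \<in> transport_maps P Q"
    "\<And>x. x \<in> P \<Longrightarrow> dist x (\<gamma> x) \<le> 2 * R"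
    "\<And>x. x \<in> P \<Longrightarrow> l *\<^sub>R x \<in> Q \<Longrightarrow> \<gamma> x = l *\<^sub>R x"
    using scaled_transport[OF P Q l] by blast
  have [measurable]: "P \<in> sets borel" "Q \<in> sets borel" using P Q by auto
  define M where "M = P - (\<lambda>x. l *\<^sub>R x) -` Q"
  have [measurable]: "(\<lambda>x. l *\<^sub>R x) -` Q \<in> sets borel" by (rule vimage_borel) auto
  have M [measurable]: "M \<in> sets borel" unfolding M_def by measurable
  have R: "0 \<le> R" using P by (metis all_not_in_conv ball_eq_empty subset_empty linorder_le_cases)
  have finP: "emeasure lborel P < \<infinity>"
    using emeasure_bounded_finite[OF bounded_subset[OF bounded_ball P(3)]] by auto
  then have finM: "emeasure lborel M < \<infinity>"
    using emeasure_mono[of M P lborel] by (auto simp: M_def)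
  have posP: "0 < measure lborel P"
    using P by (intro measure_open_pos) (auto intro: bounded_subset[OF bounded_ball])
  have Mimg: "(\<lambda>x. l *\<^sub>R x) -` ((\<lambda>x. l *\<^sub>R x) ` P - Q) = M"
    using l by (auto simp: M_def)
  have img: "(\<lambda>x. l *\<^sub>R x) ` P \<in> sets borel"
    using open_scaling[of l P] P l by auto
  have "measure lborel ((\<lambda>x. l *\<^sub>R x) ` P - Q) = l ^ DIM('a) * measure lborel M"
    using emeasure_lborel_scaleR_vimage[of "(\<lambda>x. l *\<^sub>R x) ` P - Q" l] img l
    by (simp add: Mimg measure_def enn2real_mult)
  \<comment> \<open>Scaling multiplies the volumes of \<open>M\<close> and \<open>P\<close> by the
    same factor, so the bad fraction can be read off on either side.\<close>
  then have ratio: "measure lborel ((\<lambda>x. l *\<^sub>R x) ` P - Q) / measure lborel Q = measure lborel M / measure lborel P"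
    using l by (simp add: l(2)[symmetric])
  \<comment> \<open>Only the dominating function is shown integrable. If the left integrand were
    not, its integral would be 0 by convention, and nonnegativity of the dominating function covers
    that case.\<close>
  have "(LINT x:P|lborel. \<psi> (dist x (\<gamma> x)))
      \<le> (LINT x|lborel. \<psi> (\<bar>1 - l\<bar> * R) * indicator P x + \<psi> (2 * R) * indicator M x)"
    unfolding set_lebesgue_integral_def
  proof (rule integral_mono')
    show "integrable lborel (\<lambda>x. \<psi> (\<bar>1 - l\<bar> * R) * indicator P x + \<psi> (2 * R) * indicator M x)"
      using finP finM by auto
    fix x :: 'a
    have \<psi>R: "0 \<le> \<psi> (\<bar>1 - l\<bar> * R)" "0 \<le> \<psi> (2 * R)" using R by (auto intro: mulholland_nonneg[OF \<psi>])
    then show "0 \<le> \<psi> (\<bar>1 - l\<bar> * R) * indicator P x + \<psi> (2 * R) * indicator M x" by simp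
    show "indicat_real P x *\<^sub>R \<psi> (dist x (\<gamma> x)) \<le> \<psi> (\<bar>1 - l\<bar> * R) * indicator P x + \<psi> (2 * R) * indicator M x"
    proof (cases "x \<in> P")
      case True
      show ?thesis
      proof (cases "l *\<^sub>R x \<in> Q")
        case in_Q: True
        have "dist x (\<gamma> x) = \<bar>1 - l\<bar> * norm x"
          using \<gamma>(3)[OF True in_Q]
          by (metis dist_norm norm_scaleR scaleR_left_diff_distrib scaleR_one)
        also have "\<dots> \<le> \<bar>1 - l\<bar> * R" using True P by (intro mult_left_mono) auto
        finally have "\<psi> (dist x (\<gamma> x)) \<le> \<psi> (\<bar>1 - l\<bar> * R)" by (intro mulholland_mono[OF \<psi>]) auto
        then show ?thesis using True \<psi>R by (simp add: indicator_def)
      next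
        case False
        have "\<psi> (dist x (\<gamma> x)) \<le> \<psi> (2 * R)" using \<gamma>(2)[OF True] by (intro mulholland_mono[OF \<psi>]) auto
        then show ?thesis using True False \<psi>R by (simp add: M_def)
      qed
    qed (auto simp: \<psi>R M_def)
  qed
  also have "\<dots> = \<psi> (\<bar>1 - l\<bar> * R) * measure lborel P + \<psi> (2 * R) * measure lborel M"
    using finP finM by simp
  finally have "1 / measure lborel P * (LINT x:P|lborel. \<psi> (dist x (\<gamma> x)))
      \<le> 1 / measure lborel P * (\<psi> (\<bar>1 - l\<bar> * R) * measure lborel P + \<psi> (2 * R) * measure lborel M)"
    using posP by (intro mult_left_mono) auto
  also have "\<dots> = \<psi> (\<bar>1 - l\<bar> * R) + \<psi> (2 * R) * (measure lborel M / measure lborel P)"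
    using posP by (simp add: field_simps)
  also have "\<dots> < \<psi> \<epsilon>" using small unfolding ratio[symmetric] by simp
  finally show ?thesis by (rule wasserstein_less[OF \<psi> \<epsilon> \<gamma>(1)])
qed

section \<open>Small volume of thin shells and thin slabs\<close>

lemma fmeasurable_bounded:
  fixes S :: "'a::euclidean_space set"
  assumes "S \<in> sets borel" "bounded S"
  shows "S \<in> fmeasurable lborel"
  using assms emeasure_bounded_finite[of S] by (auto intro: fmeasurableI)

text \<open>As \<open>r\<close> tends to 0, the sets
  \<open>E \<inter> {x. infdist x C \<le> r}\<close> decrease to
  \<open>E \<inter> closure C\<close>. Since \<open>E\<close> is bounded, continuity of the measure
  from above applies.\<close>

lemma measure_infdist_small:
  fixes E C :: "'a::euclidean_space set"
  assumes E: "E \<in> sets borel" "bounded E" and C: "C \<noteq> {}"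
    and null: "measure lborel (E \<inter> closure C) = 0" and \<epsilon>: "0 < \<epsilon>"
  obtains r where "r > 0" "measure lborel (E \<inter> {x. infdist x C \<le> r}) < \<epsilon>"
proof -
  define A where "A n = E \<inter> {x. infdist x C \<le> inverse (real (Suc n))}" for n
  have closed: "closed {x. infdist x C \<le> r}" for r
    by (intro closed_Collect_le continuous_intros)
  have "(\<lambda>n. measure lborel (A n)) \<longlonglongrightarrow> measure lborel (\<Inter>n. A n)"
  proof (rule Lim_measure_decseq)
    show "range A \<subseteq> sets lborel" using E closed by (auto simp: A_def)
    show "decseq A"
    proof (rule decseq_SucI)
      fix n
      have "inverse (real (Suc (Suc n))) \<le> inverse (real (Suc n))" by (rule le_imp_inverse_le) auto
      then show "A (Suc n) \<le> A n" unfolding A_def by (blast intro: order_trans)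
    qed
    fix n
    have "A n \<in> fmeasurable lborel"
      using E closed by (intro fmeasurable_bounded) (auto simp: A_def intro: bounded_subset)
    then show "emeasure lborel (A n) \<noteq> \<infinity>" by (auto simp: fmeasurable_def)
  qed
  moreover have "(\<Inter>n. A n) = E \<inter> closure C"
  proof (intro equalityI subsetI)
    fix x assume x: "x \<in> (\<Inter>n. A n)"
    have "infdist x C \<le> e" if e: "e > 0" for e
    proof -
      obtain n where "inverse (real (Suc n)) < e" using reals_Archimedean[OF e] by auto
      moreover have "infdist x C \<le> inverse (real (Suc n))" using x by (auto simp: A_def)
      ultimately show ?thesis by linarith
    qed
    then have "infdist x C = 0" using infdist_nonneg[of x C] by (metis field_le_epsilon add_0 antisym)
    then show "x \<in> E \<inter> closure C" using x C by (auto simp: in_closure_iff_infdist_zero A_def)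
  qed (auto simp: A_def in_closure_iff_infdist_zero[OF C])
  ultimately have "(\<lambda>n. measure lborel (A n)) \<longlonglongrightarrow> 0" using null by simp
  then have "eventually (\<lambda>n. measure lborel (A n) < \<epsilon>) sequentially"
    using \<epsilon> by (rule order_tendstoD)
  then obtain n where "measure lborel (A n) < \<epsilon>" by (auto simp: eventually_sequentially)
  then show thesis using that[of "inverse (real (Suc n))"] by (auto simp: A_def)
qed

text \<open>One \<open>r\<close> serves all \<open>Q\<close>: the difference \<open>Q - P\<close>
  lies in a shell depending only on \<open>P\<close> and \<open>r\<close>, and these shells shrink
  to the null set \<open>closure P - P\<close>.\<close>

lemma measure_Diff_neighbourhood_small:
  fixes P :: "'a::euclidean_space set"
  assumes P: "P \<in> sets borel" "bounded P" "P \<noteq> {}"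
    and null: "measure lborel (closure P - P) = 0" and \<epsilon>: "0 < \<epsilon>"
  obtains r where "r > 0"
    "\<And>Q. Q \<in> sets borel \<Longrightarrow> (\<And>q. q \<in> Q \<Longrightarrow> infdist q P \<le> r) \<Longrightarrow> measure lborel (Q - P) < \<epsilon>"
proof -
  \<comment> \<open>The radius 1 only serves to make \<open>E\<close> bounded; it reappears in
    \<open>min r 1\<close>.\<close>
  define E where "E = {x. infdist x P \<le> 1} - P"
  have closed: "closed {x. infdist x P \<le> r}" for r
    by (intro closed_Collect_le continuous_intros)
  obtain R where R: "P \<subseteq> ball 0 R" using P bounded_subset_ballD by blast
  have "{x. infdist x P \<le> 1} \<subseteq> ball 0 (R + 2)"
  proof
    fix x assume "x \<in> {x. infdist x P \<le> 1}"
    then obtain p where "p \<in> P" "dist x p < 2"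
      using cINF_less_iff[of P "dist x" 2] P by (auto simp: infdist_notempty)
    then show "x \<in> ball 0 (R + 2)" using R norm_triangle_ineq[of "x - p" p] by (auto simp: dist_norm subset_iff)
  qed
  then have b: "bounded E" by (auto simp: E_def intro: bounded_subset[OF bounded_ball])
  have Eb: "E \<in> sets borel" using P closed by (auto simp: E_def)
  have "E \<inter> closure P = closure P - P"
    by (auto simp: E_def in_closure_iff_infdist_zero[OF P(3)])
  then obtain r where r: "r > 0" "measure lborel (E \<inter> {x. infdist x P \<le> r}) < \<epsilon>"
    using measure_infdist_small[OF Eb b P(3) _ \<epsilon>] null by auto
  show thesis
  proof (rule that[of "min r 1"])
    fix Q :: "'a set" assume Q: "Q \<in> sets borel" "\<And>q. q \<in> Q \<Longrightarrow> infdist q P \<le> min r 1"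
    have "measure lborel (Q - P) \<le> measure lborel (E \<inter> {x. infdist x P \<le> r})"
    proof (rule measure_mono_fmeasurable)
      show "Q - P \<subseteq> E \<inter> {x. infdist x P \<le> r}" using Q by (auto simp: E_def)
      show "E \<inter> {x. infdist x P \<le> r} \<in> fmeasurable lborel"
        using Eb b closed by (intro fmeasurable_bounded) (auto intro: bounded_subset)
    qed (use Q P in auto)
    then show "measure lborel (Q - P) < \<epsilon>" using r by simp
  qed (use r in auto)
qed

text \<open>\<open>N\<close> translates of the slab, by multiples of \<open>3 * h\<close> along its normal, are disjoint.\<close>

lemma measure_slab_le:
  fixes a :: "'a::euclidean_space"
  assumes a: "a \<noteq> 0" and h: "0 < h" "3 * h * real N \<le> 1"
  shows "real N * measure lborel (ball 0 R \<inter> {x. \<bar>a \<bullet> x - b\<bar> \<le> h * norm a}) \<le> measure lborel (ball (0::'a) (R + 1))"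
proof -
  define S where "S = ball 0 R \<inter> {x. \<bar>a \<bullet> x - b\<bar> \<le> h * norm a}"
  define c where "c j = (3 * h * real j / norm a) *\<^sub>R a" for j
  have ac: "a \<bullet> c j = 3 * h * real j * norm a" for j
    using a by (simp add: c_def power2_norm_eq_inner[symmetric] power2_eq_square)
  have nc: "norm (c j) = 3 * h * real j" for j using a h by (simp add: c_def)
  have "closed {x. \<bar>a \<bullet> x - b\<bar> \<le> h * norm a}"
    by (intro closed_Collect_le continuous_intros)
  then have Sb: "S \<in> sets borel" unfolding S_def by auto
  have S: "S \<in> lmeasurable"
    using Sb by (intro bounded_set_imp_lmeasurable sets_completionI_sets) (auto simp: S_def intro: bounded_subset)
  have F: "(+) (c j) ` S \<in> lmeasurable" for j using S by (rule measurable_translation)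
  have bd: "\<bar>a \<bullet> (y - c j) - b\<bar> \<le> h * norm a" if "y \<in> (+) (c j) ` S" for y j
    using that by (auto simp: S_def)
  \<comment> \<open>Measured along the unit normal, two different shifts are at least
    \<open>3 * h\<close> apart, while the slab has width \<open>2 * h\<close>.\<close>
  have disj: "pairwise (\<lambda>i j. disjnt ((+) (c i) ` S) ((+) (c j) ` S)) {..<N}"
  proof (rule pairwiseI)
    have *: False if "i < j" "y \<in> (+) (c i) ` S" "y \<in> (+) (c j) ` S" for i j :: nat and y
    proof -
      have "a \<bullet> c j - a \<bullet> c i \<le> 2 * h * norm a"
        using bd[OF that(2)] bd[OF that(3)] by (simp add: inner_diff_right)
      moreover have "a \<bullet> c j - a \<bullet> c i = (3 * h * norm a) * (real j - real i)"
        by (simp add: ac algebra_simps)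
      moreover have "(3 * h * norm a) * 1 \<le> (3 * h * norm a) * (real j - real i)"
        using that h by (intro mult_left_mono) auto
      moreover have "0 < h * norm a" using a h by simp
      ultimately show False by linarith
    qed
    fix i j :: nat assume "i \<noteq> j"
    then show "disjnt ((+) (c i) ` S) ((+) (c j) ` S)"
      using *[of i j] *[of j i] unfolding disjnt_def by (meson disjoint_iff linorder_less_linear)
  qed
  have "real N * measure lebesgue S = (\<Sum>j<N. measure lebesgue ((+) (c j) ` S))"
    by (simp add: measure_translation)
  also have "\<dots> = measure lebesgue (\<Union>j<N. (+) (c j) ` S)"
    using F disj by (intro measure_UNION'[symmetric]) auto
  also have "\<dots> \<le> measure lebesgue (ball (0::'a) (R + 1))"
  proof (rule measure_mono_fmeasurable)
    show "(\<Union>j<N. (+) (c j) ` S) \<subseteq> ball 0 (R + 1)"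
    proof clarsimp
      fix j x assume jx: "j < N" "x \<in> S"
      have "3 * h * real j \<le> 3 * h * real N" using jx h by (intro mult_left_mono) auto
      then have "norm (c j) \<le> 1" unfolding nc using h by linarith
      moreover have "norm x < R" using jx by (simp add: S_def)
      ultimately show "norm (c j + x) < R + 1" using norm_triangle_ineq[of "c j" x] by linarith
    qed
    show "(\<Union>j<N. (+) (c j) ` S) \<in> sets lebesgue"
      using F by (intro sets.finite_UN) (auto simp: fmeasurableD)
  qed auto
  finally show ?thesis using Sb by (simp add: S_def measure_completion)
qed

section \<open>Points near one convex set or two separated ones\<close>

text \<open>Otherwise a hyperplane strictly separates \<open>p\<close> from
  \<open>closure Y\<close>. Moving \<open>p\<close> by \<open>\<delta>\<close> along the normal,
  away from \<open>Y\<close>, gives a point of the ball whose distance to \<open>Y\<close> exceeds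
  \<open>\<delta>\<close>.\<close>

lemma in_closure_convex_if_near:
  fixes Y :: "'a::euclidean_space set"
  assumes Y: "convex Y" "Y \<noteq> {}" and \<delta>: "0 \<le> \<delta>"
    and near: "\<And>z. z \<in> cball p \<delta> \<Longrightarrow> infdist z Y \<le> \<delta>"
  shows "p \<in> closure Y"
proof (rule ccontr)
  assume "p \<notin> closure Y"
  then obtain a b where ab: "a \<bullet> p < b" "\<And>x. x \<in> closure Y \<Longrightarrow> b < a \<bullet> x"
    using separating_hyperplane_closed_point[of "closure Y" p] Y by (auto simp: convex_closure)
  have a: "a \<noteq> 0" using ab Y closure_subset[of Y] by force
  define z where "z = p - (\<delta> / norm a) *\<^sub>R a"
  have az: "a \<bullet> z = a \<bullet> p - \<delta> * norm a"
    using a by (simp add: z_def inner_diff_right power2_norm_eq_inner[symmetric] power2_eq_square)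
  have "\<delta> + (b - a \<bullet> p) / norm a \<le> infdist z Y"
    unfolding infdist_notempty[OF Y(2)]
  proof (rule cINF_greatest[OF Y(2)])
    fix y assume "y \<in> Y"
    then have "b < a \<bullet> y" using ab closure_subset by blast
    then have "b - a \<bullet> p + \<delta> * norm a \<le> a \<bullet> (y - z)" by (simp add: az inner_diff_right)
    also have "\<dots> \<le> norm a * dist z y"
      using norm_cauchy_schwarz[of a "y - z"] by (simp add: dist_norm norm_minus_commute)
    finally show "\<delta> + (b - a \<bullet> p) / norm a \<le> dist z y" using a by (simp add: field_simps)
  qed
  moreover have "infdist z Y \<le> \<delta>" using \<delta> a by (intro near) (simp add: z_def dist_norm)
  moreover have "0 < (b - a \<bullet> p) / norm a" using ab a by simp
  ultimately show False by linarith
qed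

text \<open>\<open>p\<close> is more than \<open>2 * \<delta>\<close> beyond the half-space
  containing \<open>X\<close>; going to \<open>z\<close> uses up at most \<open>\<delta>\<close> of
  this.\<close>

lemma infdist_halfspace_ge:
  fixes X :: "'a::euclidean_space set"
  assumes X: "X \<noteq> {}" "\<And>x. x \<in> X \<Longrightarrow> a \<bullet> x \<le> b" and a: "a \<noteq> 0"
    and p: "b + 2 * \<delta> * norm a < a \<bullet> p" and z: "z \<in> cball p \<delta>"
  shows "\<delta> < infdist z X"
proof -
  have "(a \<bullet> p - b) / norm a - \<delta> \<le> infdist z X"
    unfolding infdist_notempty[OF X(1)]
  proof (rule cINF_greatest[OF X(1)])
    fix x assume "x \<in> X"
    then have "a \<bullet> p - b \<le> a \<bullet> (p - z) + a \<bullet> (z - x)" using X by (simp add: inner_diff_right)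
    also have "\<dots> \<le> norm a * dist p z + norm a * dist z x"
      using norm_cauchy_schwarz[of a "p - z"] norm_cauchy_schwarz[of a "z - x"] by (simp add: dist_norm)
    also have "\<dots> \<le> norm a * \<delta> + norm a * dist z x" using z by (intro add_mono mult_left_mono) auto
    finally show "(a \<bullet> p - b) / norm a - \<delta> \<le> dist z x" using a by (simp add: field_simps)
  qed
  moreover have "2 * \<delta> < (a \<bullet> p - b) / norm a" using p a by (simp add: field_simps)
  ultimately show ?thesis by linarith
qed

text \<open>The whole ball around \<open>p\<close> is too far from \<open>X\<close>, so its nearness
  to \<open>X \<union> Y\<close> comes from \<open>Y\<close> alone, and the case of one convex set
  applies.\<close>

lemma in_closure_two_convex_if_near:
  fixes X Y :: "'a::euclidean_space set"
  assumes X: "X \<noteq> {}" "\<And>x. x \<in> X \<Longrightarrow> a \<bullet> x \<le> b" and Y: "convex Y" "Y \<noteq> {}"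
    and a: "a \<noteq> 0" and \<delta>: "0 \<le> \<delta>" and p: "b + 2 * \<delta> * norm a < a \<bullet> p"
    and near: "\<And>z. z \<in> cball p \<delta> \<Longrightarrow> infdist z (X \<union> Y) \<le> \<delta>"
  shows "p \<in> closure Y"
proof (rule in_closure_convex_if_near[OF Y \<delta>])
  fix z assume z: "z \<in> cball p \<delta>"
  show "infdist z Y \<le> \<delta>"
    using near[OF z] infdist_halfspace_ge[OF X a p z] by (simp add: infdist_Un_min[OF X(1) Y(2)])
qed

section \<open>Null boundaries and the volume that a nearby region can miss\<close>

lemma measure_closure_Diff_convex:
  fixes S :: "'a::euclidean_space set"
  assumes "convex S" "open S"
  shows "measure lborel (closure S - S) = 0"
proof -
  have "negligible (closure S - S)"
    using negligible_convex_frontier[OF assms(1)] assms(2) by (simp add: frontier_def interior_open)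
  then have "measure lebesgue (closure S - S) = 0" by (rule negligible_imp_measure0)
  then show ?thesis using assms by (simp add: measure_completion)
qed

text \<open>Writing a convex region as \<open>X \<union> X\<close> lets both kinds of region be
  treated together. Positive distance enters as disjointness, which is what a separating hyperplane
  requires.\<close>

lemma region_space_cases:
  assumes "Q \<in> region_space"
  obtains X Y where "Q = X \<union> Y" "X \<in> convex_regions" "Y \<in> convex_regions" "X = Y \<or> X \<inter> Y = {}"
proof (cases "Q \<in> convex_regions")
  case True
  then show thesis using that[of Q Q] by simp
next
  case False
  then obtain X Y where "Q = X \<union> Y" "X \<in> convex_regions" "Y \<in> convex_regions" "region_dist X Y > 0"
    using assms by (auto simp: region_space_def two_convex_regions_def)
  moreover from this have "X \<inter> Y = {}"
    using setdist_eq_0I[of _ "closure X" "closure Y"] closure_subset[of X] closure_subset[of Y]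
    by (force simp: region_dist_def)
  ultimately show thesis using that by blast
qed

lemma region_space_props:
  fixes Q :: "'a::euclidean_space set"
  assumes "Q \<in> region_space"
  shows "open Q" "Q \<noteq> {}" "bounded Q" "measure lborel (closure Q - Q) = 0"
proof -
  obtain X Y where Q: "Q = X \<union> Y" and X: "X \<in> convex_regions" and Y: "Y \<in> convex_regions"
    using region_space_cases[OF assms] by metis
  have XY: "open X" "open Y" "convex X" "convex Y" "bounded X" "bounded Y" "X \<noteq> {}"
    using X Y by (auto simp: convex_regions_def region_def)
  then show "open Q" "Q \<noteq> {}" "bounded Q" by (auto simp: Q)
  have "measure lborel (closure Q - Q) \<le> measure lborel ((closure X - X) \<union> (closure Y - Y))"
    using XY by (intro measure_mono_fmeasurable fmeasurable_bounded) (auto simp: Q closure_Un)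
  also have "\<dots> \<le> measure lborel (closure X - X) + measure lborel (closure Y - Y)"
    using XY by (intro measure_Un_le) auto
  also have "\<dots> = 0" using XY by (simp add: measure_closure_Diff_convex)
  finally show "measure lborel (closure Q - Q) = 0" by (simp add: antisym)
qed

text \<open>The hyperplane separates the two pieces of \<open>Q\<close>. Further than
  \<open>2 * \<delta>\<close> from it one piece is out of reach, so \<open>p\<close> must belong to
  the closure of the other.\<close>

lemma region_space_near_slab:
  fixes Q :: "'a::euclidean_space set"
  assumes Q: "Q \<in> region_space" and \<delta>: "0 \<le> \<delta>"
  obtains a b where "a \<noteq> 0"
    "\<And>p. (\<And>z. z \<in> cball p \<delta> \<Longrightarrow> infdist z Q \<le> \<delta>) \<Longrightarrow>
      p \<in> closure Q \<or> \<bar>a \<bullet> p - b\<bar> \<le> 2 * \<delta> * norm a"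
proof -
  obtain X Y where QXY: "Q = X \<union> Y" and X: "X \<in> convex_regions" and Y: "Y \<in> convex_regions"
    and alt: "X = Y \<or> X \<inter> Y = {}"
    using region_space_cases[OF Q] by metis
  have XY: "convex X" "convex Y" "X \<noteq> {}" "Y \<noteq> {}"
    using X Y by (auto simp: convex_regions_def region_def)
  show thesis
  proof (cases "X = Y")
    case True
    have "p \<in> closure Q" if "\<And>z. z \<in> cball p \<delta> \<Longrightarrow> infdist z Q \<le> \<delta>" for p
      using in_closure_convex_if_near[of Q \<delta> p] XY \<delta> that True QXY by simp
    \<comment> \<open>For a single convex piece the first alternative always holds, so any slab may
      be returned.\<close>
    moreover obtain a :: 'a where "a \<noteq> 0" using nonzero_Basis[OF SOME_Basis] by blast
    ultimately show thesis using that[of a] by blast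
  next
    case False
    then obtain a b where a: "a \<noteq> 0" and ab: "\<And>x. x \<in> X \<Longrightarrow> a \<bullet> x \<le> b" "\<And>x. x \<in> Y \<Longrightarrow> a \<bullet> x \<ge> b"
      using separating_hyperplane_sets[OF XY] alt by metis
    have "p \<in> closure Q" if near: "\<And>z. z \<in> cball p \<delta> \<Longrightarrow> infdist z Q \<le> \<delta>"
      and "\<not> \<bar>a \<bullet> p - b\<bar> \<le> 2 * \<delta> * norm a" for p
    proof -
      \<comment> \<open>The second case is the first for the reversed normal, with \<open>X\<close>
        and \<open>Y\<close> exchanged.\<close>
      have "b + 2 * \<delta> * norm a < a \<bullet> p \<or> - b + 2 * \<delta> * norm (- a) < (- a) \<bullet> p"
        using that(2) by (auto simp: abs_real_def split: if_splits)
      then consider "b + 2 * \<delta> * norm a < a \<bullet> p" | "- b + 2 * \<delta> * norm (- a) < (- a) \<bullet> p"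
        by blast
      then show ?thesis
      proof cases
        case 1
        then have "p \<in> closure Y"
          using in_closure_two_convex_if_near[of X a b Y \<delta> p] XY ab a \<delta> near QXY by simp
        then show ?thesis by (simp add: QXY closure_Un)
      next
        case 2
        then have "p \<in> closure X"
          using in_closure_two_convex_if_near[of Y "- a" "- b" X \<delta> p] XY ab a \<delta> near QXY
          by (simp add: Un_commute)
        then show ?thesis by (simp add: QXY closure_Un)
      qed
    qed
    then show thesis using that[OF a] by blast
  qed
qed

text \<open>The slab depends on \<open>Q\<close>, but the bound on its volume inside a ball depends
  only on its width, so \<open>\<delta>\<close> can be chosen before \<open>Q\<close>. Up to the
  null set \<open>closure Q - Q\<close>, the missed part is covered by a boundary layer
  \<open>K\<close> of \<open>P\<close> and a slab \<open>S\<close>, each of volume below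
  \<open>\<epsilon> / 2\<close>.\<close>

lemma measure_Diff_region_small:
  fixes P :: "'a::euclidean_space set"
  assumes P: "open P" "bounded P" and \<epsilon>: "0 < \<epsilon>"
  obtains \<delta> where "\<delta> > 0"
    "\<And>Q. Q \<in> region_space \<Longrightarrow> (\<And>p. p \<in> P \<Longrightarrow> infdist p Q \<le> \<delta>) \<Longrightarrow> measure lborel (P - Q) < \<epsilon>"
proof -
  have ne: "- P \<noteq> {}" using P not_bounded_UNIV by (metis Compl_UNIV_eq double_complement)
  have "P \<inter> closure (- P) = {}" using P by (simp add: closure_complement interior_open)
  then obtain r where r: "r > 0" "measure lborel (P \<inter> {x. infdist x (- P) \<le> r}) < \<epsilon> / 2"
    using measure_infdist_small[of P "- P" "\<epsilon> / 2"] P ne \<epsilon> by auto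
  obtain R where R: "P \<subseteq> ball 0 R" using P bounded_subset_ballD by blast
  define V where "V = measure lborel (ball (0::'a) (R + 1))"
  obtain N where N: "real N > V / (\<epsilon> / 2)" using reals_Archimedean2 by blast
  have Npos: "0 < real N" using N \<epsilon> by (smt (verit) V_def measure_nonneg divide_nonneg_nonneg)
  \<comment> \<open>The first bound gives \<open>\<delta> < r\<close>; the second lets
    \<open>N\<close> disjoint translates of a slab of half-width \<open>2 * \<delta>\<close> fit
    into the ball of radius \<open>R + 1\<close>, whose volume is below
    \<open>N * (\<epsilon> / 2)\<close>.\<close>
  define \<delta> where "\<delta> = min (r / 2) (1 / (6 * real N))"
  have \<delta>: "\<delta> > 0" "\<delta> < r" "3 * (2 * \<delta>) * real N \<le> 1"
    using r Npos by (auto simp: \<delta>_def min_def field_simps)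
  show thesis
  proof (rule that[OF \<delta>(1)])
    fix Q :: "'a set" assume Q: "Q \<in> region_space" and near: "\<And>p. p \<in> P \<Longrightarrow> infdist p Q \<le> \<delta>"
    note Qp = region_space_props[OF Q]
    obtain a b where a: "a \<noteq> 0" and ab: "\<And>p. (\<And>z. z \<in> cball p \<delta> \<Longrightarrow> infdist z Q \<le> \<delta>) \<Longrightarrow>
        p \<in> closure Q \<or> \<bar>a \<bullet> p - b\<bar> \<le> 2 * \<delta> * norm a"
      using region_space_near_slab[OF Q, of \<delta>] \<delta> by auto
    define K where "K = P \<inter> {x. infdist x (- P) \<le> r}"
    define S where "S = ball 0 R \<inter> {x. \<bar>a \<bullet> x - b\<bar> \<le> 2 * \<delta> * norm a}"
    have "closed {x. infdist x (- P) \<le> r}" "closed {x. \<bar>a \<bullet> x - b\<bar> \<le> 2 * \<delta> * norm a}"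
      by (intro closed_Collect_le continuous_intros)+
    then have Kb: "K \<in> sets borel" and Sb: "S \<in> sets borel" unfolding K_def S_def using P by auto
    have Zb: "closure Q - Q \<in> sets borel" using Qp by auto
    have bdd: "bounded (K \<union> S \<union> (closure Q - Q))"
      using P Qp by (auto simp: K_def S_def intro: bounded_subset)
    \<comment> \<open>If \<open>p\<close> is further than \<open>r\<close> from the complement of
      \<open>P\<close>, the whole \<open>\<delta>\<close>-ball around \<open>p\<close> lies in
      \<open>P\<close>, so all of its points are near \<open>Q\<close>.\<close>
    have sub: "P - Q \<subseteq> K \<union> S \<union> (closure Q - Q)"
    proof
      fix p assume p: "p \<in> P - Q"
      show "p \<in> K \<union> S \<union> (closure Q - Q)"
      proof (cases "infdist p (- P) \<le> r")
        case False
        have "z \<in> P" if "z \<in> cball p \<delta>" for z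
          using infdist_le[of z "- P" p] that False \<delta> by auto
        then have "p \<in> closure Q \<or> \<bar>a \<bullet> p - b\<bar> \<le> 2 * \<delta> * norm a"
          by (intro ab near)
        then show ?thesis using p R by (auto simp: S_def)
      qed (use p in \<open>simp add: K_def\<close>)
    qed
    have "real N * measure lborel S \<le> V"
      using measure_slab_le[OF a, of "2 * \<delta>" N R b] \<delta> by (simp add: S_def V_def)
    moreover have "V < real N * (\<epsilon> / 2)" using N \<epsilon> by (simp add: field_simps)
    ultimately have S\<epsilon>: "measure lborel S < \<epsilon> / 2"
      using Npos by (metis le_less_trans mult_less_cancel_left_pos)
    have "measure lborel (P - Q) \<le> measure lborel (K \<union> S \<union> (closure Q - Q))"
      using sub P Qp Kb Sb Zb bdd by (intro measure_mono_fmeasurable fmeasurable_bounded) auto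
    also have "\<dots> \<le> measure lborel (K \<union> S) + measure lborel (closure Q - Q)"
      using Kb Sb Zb by (intro measure_Un_le) auto
    also have "\<dots> \<le> measure lborel K + measure lborel S"
      using Kb Sb Qp measure_Un_le[of K lborel S] by simp
    also have "\<dots> < \<epsilon>" using S\<epsilon> r by (simp add: K_def)
    finally show "measure lborel (P - Q) < \<epsilon>" .
  qed
qed

section \<open>Wasserstein distance controlled by volume and by Hausdorff distance\<close>

text \<open>Boundedness of \<open>P\<close> makes the supremum over the reals meaningful; distances
  to \<open>Q\<close> and to its closure agree.\<close>

lemma infdist_le_hausdorff:
  fixes P Q :: "'a::euclidean_space set"
  assumes "bounded P" "Q \<noteq> {}" "x \<in> P"
  shows "infdist x Q \<le> directed_hausdorff P Q"
proof -
  obtain q where q: "q \<in> Q" using assms by auto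
  obtain R where R: "\<And>p. p \<in> P \<Longrightarrow> dist q p \<le> R" using assms(1) by (auto simp: bounded_any_center[of P q])
  have "bdd_above ((\<lambda>p. infdist p (closure Q)) ` P)"
  proof (rule bdd_aboveI2)
    fix p assume "p \<in> P"
    then show "infdist p (closure Q) \<le> R"
      using R[of p] q closure_subset[of Q] by (intro infdist_le2[of q]) (auto simp: dist_commute)
  qed
  then have "infdist x (closure Q) \<le> directed_hausdorff P Q"
    unfolding directed_hausdorff_def using assms by (intro cSUP_upper) auto
  then show ?thesis using infdist_eq_setdist by (metis setdist_closure_2)
qed

text \<open>Close volumes force the scale factor \<open>l\<close> close to 1, so the homothety costs
  little and \<open>L\<close> stays in a thin shell around \<open>P\<close>. Hence little of
  \<open>L\<close> falls outside \<open>Q\<close>.\<close>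

lemma wasserstein_small_if_measure_close:
  fixes P :: "'a::euclidean_space set"
  assumes \<psi>: "mulholland \<psi>" and P: "open P" "P \<noteq> {}" "P \<subseteq> ball 0 R"
    and null: "measure lborel (closure P - P) = 0" and \<epsilon>: "0 < \<epsilon>"
  obtains \<delta> where "\<delta> > 0"
    "\<And>Q. open Q \<Longrightarrow> Q \<noteq> {} \<Longrightarrow> Q \<subseteq> ball 0 R \<Longrightarrow> measure lborel (P - Q) < \<delta> \<Longrightarrow>
      measure lborel (Q - P) < \<delta> \<Longrightarrow> wasserstein \<psi> P Q < \<epsilon>"
proof -
  have bP: "bounded P" using P bounded_ball bounded_subset by blast
  define p where "p = measure lborel P"
  have p: "0 < p" unfolding p_def by (rule measure_open_pos[OF P(1,2) bP])
  have R: "0 < R" using P by (metis ball_eq_empty not_le subset_empty)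
  have \<psi>\<epsilon>: "0 < \<psi> \<epsilon>"
    using \<psi> \<epsilon> strict_mono_onD[of "{0..}" \<psi> 0 \<epsilon>] by (auto simp: mulholland_def)
  \<comment> \<open>The budget is \<open>\<psi> \<epsilon> / 4\<close> for the homothety and
    \<open>\<psi> \<epsilon> / 2\<close> for the rearrangement.\<close>
  define \<eta> where "\<eta> = inv_nonneg \<psi> (\<psi> \<epsilon> / 4)"
  have \<psi>\<eta>: "\<psi> \<eta> = \<psi> \<epsilon> / 4" and "0 \<le> \<eta>"
    using mulholland_inverse[OF \<psi>, of "\<psi> \<epsilon> / 4"] \<psi>\<epsilon> by (auto simp: \<eta>_def)
  moreover have "\<eta> \<noteq> 0" using \<psi>\<eta> \<psi>\<epsilon> \<psi> by (auto simp: mulholland_def)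
  ultimately have \<eta>: "0 < \<eta>" by simp
  define B where "B = \<psi> (2 * R)"
  have B: "0 \<le> B" unfolding B_def using R by (intro mulholland_nonneg[OF \<psi>]) simp
  \<comment> \<open>A misplaced volume of \<open>2 * \<kappa>\<close>, relative to a total above
    \<open>p / 2\<close> and at unit cost \<open>B\<close>, stays within
    \<open>\<psi> \<epsilon> / 2\<close>. The summand 1 keeps the denominator positive when only
    \<open>0 \<le> B\<close> is known.\<close>
  define \<kappa> where "\<kappa> = \<psi> \<epsilon> * p / (8 * (B + 1))"
  have \<kappa>: "0 < \<kappa>" using \<psi>\<epsilon> p B by (simp add: \<kappa>_def)
  obtain r where r: "r > 0" and rP: "\<And>Q. Q \<in> sets borel \<Longrightarrow> (\<And>q. q \<in> Q \<Longrightarrow> infdist q P \<le> r) \<Longrightarrow>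
      measure lborel (Q - P) < \<kappa>"
    using measure_Diff_neighbourhood_small[OF _ bP P(2) null \<kappa>] P by auto
  \<comment> \<open>\<open>l\<close> will be the root of the volume ratio, so a ratio within
    \<open>s\<close> of 1 makes \<open>\<bar>1 - l\<bar> * R\<close> smaller than both
    \<open>\<eta>\<close> and \<open>r\<close>.\<close>
  have "isCont (root DIM('a)) 1" by (rule isCont_real_root)
  then obtain s where s: "s > 0" "\<And>x. dist x 1 < s \<Longrightarrow> dist (root DIM('a) x) 1 < min \<eta> r / R"
  proof -
    have "0 < min \<eta> r / R" using \<eta> r R by simp
    moreover have "root DIM('a) 1 = 1" by simp
    ultimately show ?thesis
      using \<open>isCont (root DIM('a)) 1\<close> that unfolding continuous_at_eps_delta by metis
  qed
  \<comment> \<open>In turn, these bounds give \<open>q > p / 2\<close>, a volume of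
    \<open>P - Q\<close> below \<open>\<kappa>\<close>, and \<open>q / p\<close> within
    \<open>s\<close> of 1.\<close>
  define \<delta> where "\<delta> = min (p / 2) (min \<kappa> (s * p))"
  show thesis
  proof (rule that[of \<delta>])
    show "\<delta> > 0" using p \<kappa> s by (simp add: \<delta>_def)
    fix Q :: "'a set" assume Q: "open Q" "Q \<noteq> {}" "Q \<subseteq> ball 0 R"
      and PQ: "measure lborel (P - Q) < \<delta>" and QP: "measure lborel (Q - P) < \<delta>"
    have bQ: "bounded Q" using Q bounded_ball bounded_subset by blast
    define q where "q = measure lborel Q"
    have fm: "P \<in> fmeasurable lborel" "Q \<in> fmeasurable lborel"
      using P Q bP bQ by (auto intro: fmeasurable_bounded)
    have "p = measure lborel (P \<inter> Q) + measure lborel (P - Q)"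
      using fm measure_Un2[of "P \<inter> Q" lborel P] measurable_measure_Diff[of P lborel "P \<inter> Q"]
      by (simp add: p_def fmeasurable.Int fmeasurableD Diff_Int)
    moreover have "q = measure lborel (P \<inter> Q) + measure lborel (Q - P)"
      using fm measurable_measure_Diff[of Q lborel "P \<inter> Q"]
      by (simp add: q_def fmeasurable.Int fmeasurableD Diff_Int)
    ultimately have "\<bar>q - p\<bar> < \<delta>" using PQ QP by (smt (verit) measure_nonneg)
    then have "\<bar>q - p\<bar> < p / 2" and qs: "\<bar>q - p\<bar> < s * p" by (auto simp: \<delta>_def)
    then have qp: "q > p / 2" by linarith
    have "q / p - 1 = (q - p) / p" using p by (simp add: diff_divide_distrib)
    then have "dist (q / p) 1 < s" using p qs by (simp add: dist_real_def pos_divide_less_eq)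
    define l where "l = root DIM('a) (q / p)"
    have l: "l > 0" "l ^ DIM('a) * measure lborel P = measure lborel Q"
      using p qp by (auto simp: l_def p_def[symmetric] q_def[symmetric])
    have "\<bar>1 - l\<bar> < min \<eta> r / R"
      using s(2)[OF \<open>dist (q / p) 1 < s\<close>] by (simp add: l_def dist_real_def abs_minus_commute)
    then have lR: "\<bar>1 - l\<bar> * R \<le> \<eta>" "\<bar>1 - l\<bar> * R \<le> r" using R by (auto simp: field_simps)
    define L where "L = (\<lambda>x. l *\<^sub>R x) ` P"
    have oL: "open L" unfolding L_def using P l by (intro open_scaling) auto
    have bL: "bounded L" unfolding L_def by (rule bounded_scaling[OF bP])
    have "measure lborel (L - P) < \<kappa>"
    proof (rule rP)
      fix y assume "y \<in> L"
      then obtain x where x: "x \<in> P" "y = l *\<^sub>R x" by (auto simp: L_def)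
      have "dist y x = \<bar>1 - l\<bar> * norm x"
        unfolding x(2) dist_commute[of "l *\<^sub>R x"] dist_norm norm_scaleR[symmetric]
        by (simp add: scaleR_left_diff_distrib norm_minus_commute)
      also have "\<dots> \<le> \<bar>1 - l\<bar> * R" using x P by (intro mult_left_mono) auto
      finally show "infdist y P \<le> r" using x lR by (intro infdist_le2[of x]) auto
    qed (use oL in auto)
    moreover have "measure lborel (L - Q) \<le> measure lborel ((L - P) \<union> (P - Q))"
      using oL bL bP P Q by (intro measure_mono_fmeasurable fmeasurable_bounded) auto
    moreover have "\<dots> \<le> measure lborel (L - P) + measure lborel (P - Q)"
      using oL P Q by (intro measure_Un_le) auto
    ultimately have LQ: "measure lborel (L - Q) < 2 * \<kappa>" using PQ by (simp add: \<delta>_def)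
    have "B * measure lborel (L - Q) / q \<le> B * (2 * \<kappa>) / (p / 2)"
      using LQ B qp p \<kappa> by (intro frac_le mult_left_mono mult_nonneg_nonneg) auto
    also have "\<dots> = 4 * B * \<kappa> / p" by simp
    also have "\<dots> = \<psi> \<epsilon> / 2 * (B / (B + 1))" 
    proof -
      have "4 * B * (e * p / (8 * X)) / p = e / 2 * (B / X)" if "X \<noteq> 0" for e X
        using that p by (simp add: field_simps)
      then show ?thesis unfolding \<kappa>_def using B by (smt (verit))
    qed
    also have "\<dots> \<le> \<psi> \<epsilon> / 2 * 1" using B \<psi>\<epsilon> by (intro mult_left_mono) auto
    finally have "B * measure lborel (L - Q) / q \<le> \<psi> \<epsilon> / 2" by simp
    moreover have "\<psi> (\<bar>1 - l\<bar> * R) \<le> \<psi> \<epsilon> / 4"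
      using mulholland_mono[OF \<psi> _ lR(1)] R by (simp add: \<psi>\<eta>)
    ultimately show "wasserstein \<psi> P Q < \<epsilon>"
      using \<psi>\<epsilon> \<epsilon> by (intro wasserstein_less_scaled[OF \<psi> _ P Q l]) (auto simp: L_def B_def q_def)
  qed
qed

text \<open>The two halves of the symmetric difference are handled differently: \<open>Q - P\<close>
  lies in a thin shell around \<open>P\<close>, while \<open>P - Q\<close> is bounded through the
  convex pieces of \<open>Q\<close>.\<close>

lemma wasserstein_small_if_hausdorff_small:
  fixes P :: "'a::euclidean_space set"
  assumes \<psi>: "mulholland \<psi>" and P: "P \<in> region_space" and \<epsilon>: "0 < \<epsilon>"
  obtains \<delta> where "\<delta> > 0"
    "\<And>Q. Q \<in> region_space \<Longrightarrow> hausdorff P Q < \<delta> \<Longrightarrow> wasserstein \<psi> P Q < \<epsilon>"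
proof -
  note Pp = region_space_props[OF P]
  obtain R0 where R0: "P \<subseteq> ball 0 R0" using Pp bounded_subset_ballD by blast
  \<comment> \<open>A Hausdorff distance below 1 keeps every \<open>Q\<close> considered inside this
    one ball.\<close>
  define R where "R = R0 + 1"
  have PR: "P \<subseteq> ball 0 R" using R0 by (auto simp: R_def)
  obtain \<kappa> where \<kappa>: "\<kappa> > 0"
    "\<And>Q. open Q \<Longrightarrow> Q \<noteq> {} \<Longrightarrow> Q \<subseteq> ball 0 R \<Longrightarrow> measure lborel (P - Q) < \<kappa> \<Longrightarrow>
      measure lborel (Q - P) < \<kappa> \<Longrightarrow> wasserstein \<psi> P Q < \<epsilon>"
    using wasserstein_small_if_measure_close[OF \<psi> Pp(1,2) PR Pp(4) \<epsilon>] by metis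
  obtain r where r: "r > 0" "\<And>Q. Q \<in> sets borel \<Longrightarrow> (\<And>q. q \<in> Q \<Longrightarrow> infdist q P \<le> r) \<Longrightarrow>
      measure lborel (Q - P) < \<kappa>"
    using measure_Diff_neighbourhood_small[OF borel_open[OF Pp(1)] Pp(3,2,4) \<kappa>(1)] by metis
  obtain t where t: "t > 0" "\<And>Q. Q \<in> region_space \<Longrightarrow> (\<And>p. p \<in> P \<Longrightarrow> infdist p Q \<le> t) \<Longrightarrow>
      measure lborel (P - Q) < \<kappa>"
    using measure_Diff_region_small[OF Pp(1,3) \<kappa>(1)] by metis
  show thesis
  proof (rule that[of "min 1 (min r t)"])
    fix Q :: "'a set" assume Q: "Q \<in> region_space" and H: "hausdorff P Q < min 1 (min r t)"
    note Qp = region_space_props[OF Q]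
    have PQ: "infdist x Q < min 1 (min r t)" if "x \<in> P" for x
      using infdist_le_hausdorff[OF Pp(3) Qp(2) that] H by (auto simp: hausdorff_def)
    have QP: "infdist x P < min 1 (min r t)" if "x \<in> Q" for x
      using infdist_le_hausdorff[OF Qp(3) Pp(2) that] H by (auto simp: hausdorff_def)
    have "Q \<subseteq> ball 0 R"
    proof
      fix x assume "x \<in> Q"
      then have "infdist x P < 1" using QP by auto
      then obtain y where "y \<in> P" "dist x y < 1"
        using cINF_less_iff[of P "dist x" 1] Pp by (auto simp: infdist_notempty)
      then show "x \<in> ball 0 R"
        using R0 norm_triangle_ineq[of "x - y" y] by (auto simp: dist_norm subset_iff R_def)
    qed
    moreover have "measure lborel (Q - P) < \<kappa>"
      using QP Qp by (intro r) (auto intro: less_imp_le)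
    moreover have "measure lborel (P - Q) < \<kappa>"
      using PQ Q by (intro t) (auto intro: less_imp_le)
    ultimately show "wasserstein \<psi> P Q < \<epsilon>" using Qp by (intro \<kappa>) auto
  qed (use r t in auto)
qed

section \<open>Strictness: a small distant ball added to the unit ball\<close>

lemma ball_convex_region: "0 < r \<Longrightarrow> ball (c::'a::euclidean_space) r \<in> convex_regions"
  by (simp add: convex_regions_def region_def)

lemma balls_in_region_space:
  fixes c d :: "'a::euclidean_space"
  assumes "0 < r" "0 < s" "r + s < dist c d"
  shows "ball c r \<union> ball d s \<in> region_space"
proof -
  have "cball c r \<inter> cball d s = {}"
    using assms(3) by (intro equals0I) (auto, smt (verit) dist_triangle dist_commute)
  then have "region_dist (ball c r) (ball d s) \<noteq> 0"
    using assms by (simp add: region_dist_def setdist_eq_0_compact_closed)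
  then have "region_dist (ball c r) (ball d s) > 0"
    using setdist_pos_le[of "closure (ball c r)" "closure (ball d s)"] unfolding region_dist_def by linarith
  then show ?thesis
    using assms ball_convex_region[of r c] ball_convex_region[of s d]
    unfolding region_space_def two_convex_regions_def by blast
qed

text \<open>The slack \<open>\<rho> - s\<close> absorbs a Hausdorff perturbation; spending half of
  it leaves the new radius \<open>s + r\<close> strictly below \<open>\<rho>\<close>.\<close>

lemma hausdorff_open_inner_radius:
  "openin (generated_topology region_space hausdorff)
     {Q \<in> region_space. \<exists>s<\<rho>. Q \<subseteq> ball (0::'a::euclidean_space) s}"
  unfolding openin_generated_topology
proof (intro conjI ballI)
  fix P :: "'a set" assume "P \<in> {Q \<in> region_space. \<exists>s<\<rho>. Q \<subseteq> ball 0 s}"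
  then obtain s where P: "P \<in> region_space" and s: "s < \<rho>" "P \<subseteq> ball 0 s" by blast
  note Pp = region_space_props[OF P]
  define r where "r = (\<rho> - s) / 2"
  have "Q \<subseteq> ball 0 (s + r)" if Q: "Q \<in> region_space" and H: "hausdorff P Q < r" for Q
  proof
    note Qp = region_space_props[OF Q]
    fix x assume "x \<in> Q"
    then have "infdist x P < r"
      using infdist_le_hausdorff[OF Qp(3) Pp(2), of x] H by (auto simp: hausdorff_def)
    then obtain y where "y \<in> P" "dist x y < r"
      using cINF_less_iff[of P "dist x" r] Pp by (auto simp: infdist_notempty)
    then show "x \<in> ball 0 (s + r)"
      using s norm_triangle_ineq[of "x - y" y] by (auto simp: dist_norm subset_iff)
  qed
  moreover have "r > 0" "s + r < \<rho>" using s by (auto simp: r_def field_simps)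
  ultimately show "\<exists>r>0. {Q \<in> region_space. hausdorff P Q < r} \<subseteq> {Q \<in> region_space. \<exists>s<\<rho>. Q \<subseteq> ball 0 s}"
    by blast
qed auto

text \<open>The unit ball belongs to the set, but adding a ball of radius \<open>\<eta>\<close>
  around a point of norm 3 leaves it, while the volume changes only by a multiple of
  \<open>\<eta> ^ DIM('a)\<close>.\<close>

lemma wasserstein_not_open_inner_radius:
  assumes \<psi>: "mulholland \<psi>"
  shows "\<not> openin (generated_topology region_space (wasserstein \<psi>))
     {Q \<in> region_space. \<exists>s<2. Q \<subseteq> ball (0::'a::euclidean_space) s}" (is "\<not> openin _ ?U")
proof
  assume op: "openin (generated_topology region_space (wasserstein \<psi>)) ?U"
  define P where "P = ball (0::'a) 1"
  have P: "P \<in> region_space" unfolding P_def region_space_def using ball_convex_region[of 1 "0::'a"] by simp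
  note Pp = region_space_props[OF P]
  have "P \<in> ?U" using P by (auto simp: P_def intro!: exI[of _ 1])
  then obtain \<epsilon> where \<epsilon>: "\<epsilon> > 0" "{Q \<in> region_space. wasserstein \<psi> P Q < \<epsilon>} \<subseteq> ?U"
    using op unfolding openin_generated_topology by blast
  have "P \<subseteq> ball 0 4" by (auto simp: P_def)
  then obtain \<kappa> where \<kappa>: "\<kappa> > 0"
    "\<And>Q. open Q \<Longrightarrow> Q \<noteq> {} \<Longrightarrow> Q \<subseteq> ball 0 4 \<Longrightarrow> measure lborel (P - Q) < \<kappa> \<Longrightarrow>
      measure lborel (Q - P) < \<kappa> \<Longrightarrow> wasserstein \<psi> P Q < \<epsilon>"
    using wasserstein_small_if_measure_close[OF \<psi> Pp(1,2) _ Pp(4) \<epsilon>(1)] by metis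
  obtain e :: 'a where e: "norm e = 1" using norm_Basis[OF SOME_Basis] by blast
  \<comment> \<open>With \<open>\<eta> < 1\<close>, norm 3 keeps the two closed balls apart, puts
    \<open>c\<close> outside the ball of radius 2, and leaves everything within radius 4.\<close>
  define c where "c = 3 *\<^sub>R e"
  have c: "norm c = 3" by (simp add: c_def e)
  have cont: "((\<lambda>\<eta>. \<eta> ^ DIM('a) * measure lborel (ball (0::'a) 1)) \<longlongrightarrow> 0 ^ DIM('a) * measure lborel (ball (0::'a) 1)) (at_right 0)"
    by (intro tendsto_intros)
  then have "eventually (\<lambda>\<eta>. \<eta> ^ DIM('a) * measure lborel (ball (0::'a) 1) < \<kappa>) (at_right 0)"
    using \<kappa>(1) by (intro order_tendstoD(2)[OF cont]) (simp add: zero_power)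
  moreover have "eventually (\<lambda>\<eta>::real. \<eta> \<in> {0<..<1}) (at_right 0)"
    by (rule eventually_at_right_real) simp
  ultimately have "eventually (\<lambda>\<eta>. \<eta> ^ DIM('a) * measure lborel (ball (0::'a) 1) < \<kappa> \<and> \<eta> \<in> {0<..<1}) (at_right 0)"
    by (rule eventually_conj)
  then obtain \<eta> where \<eta>: "0 < \<eta>" "\<eta> < 1" "\<eta> ^ DIM('a) * measure lborel (ball (0::'a) 1) < \<kappa>"
    using eventually_happens[of _ "at_right (0::real)"] by (auto simp: trivial_limit_at_right_real)
  define Q where "Q = P \<union> ball c \<eta>"
  have Q: "Q \<in> region_space"
    unfolding Q_def P_def using \<eta> c by (intro balls_in_region_space) auto
  have "ball c \<eta> \<subseteq> ball 0 4"
  proof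
    fix x assume "x \<in> ball c \<eta>"
    then have "norm (x - c) < 1" using \<eta> by (simp add: dist_norm norm_minus_commute)
    then show "x \<in> ball 0 4" using c norm_triangle_ineq[of "x - c" c] by simp
  qed
  then have "Q \<subseteq> ball 0 4" using \<open>P \<subseteq> ball 0 4\<close> by (simp add: Q_def)
  moreover have "measure lborel (Q - P) \<le> measure lborel (ball c \<eta>)"
    using Pp(1) by (intro measure_mono_fmeasurable fmeasurable_bounded) (auto simp: Q_def)
  then have "measure lborel (Q - P) < \<kappa>" using \<eta> content_ball_conv_unit_ball[of \<eta> c] by simp
  moreover have "measure lborel (P - Q) = 0"
  proof -
    have "P - Q = {}" by (auto simp: Q_def)
    then show ?thesis by (simp only: measure_empty)
  qed
  ultimately have "wasserstein \<psi> P Q < \<epsilon>"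
    using region_space_props[OF Q] \<kappa>(1) by (intro \<kappa>(2)) simp_all
  then have "Q \<in> ?U" using \<epsilon> Q by blast
  then obtain s where "s < 2" "Q \<subseteq> ball 0 s" by blast
  moreover have "c \<in> Q" using \<eta> by (simp add: Q_def)
  ultimately show False using c by auto
qed

theorem theorem14:
  fixes \<psi> :: "real \<Rightarrow> real"
  assumes "2 \<le> DIM('a::euclidean_space)"
    and "mulholland \<psi>"
  shows "strictly_finer
    (generated_topology (region_space :: 'a set set) hausdorff)
    (generated_topology (region_space :: 'a set set) (wasserstein \<psi>))"
proof -
  \<comment> \<open>A Hausdorff radius depending on the point \<open>P\<close> is enough to compare
    the topologies.\<close>
  have "openin (generated_topology region_space hausdorff) U"
    if U: "openin (generated_topology region_space (wasserstein \<psi>)) U" for U :: "'a set set"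
    unfolding openin_generated_topology
  proof (intro conjI ballI)
    show "U \<subseteq> region_space" using U by (simp add: openin_generated_topology)
    fix P assume "P \<in> U"
    then obtain \<epsilon> where "\<epsilon> > 0" "{Q \<in> region_space. wasserstein \<psi> P Q < \<epsilon>} \<subseteq> U" "P \<in> region_space"
      using U unfolding openin_generated_topology by blast
    then show "\<exists>r>0. {Q \<in> region_space. hausdorff P Q < r} \<subseteq> U"
      using wasserstein_small_if_hausdorff_small[OF assms(2), of P \<epsilon>] by (smt (verit) mem_Collect_eq subset_eq)
  qed
  \<comment> \<open>The inclusion is proper because the regions lying in a ball of radius below 2
    form a Hausdorff open set that is not Wasserstein open.\<close>
  then show ?thesis
    unfolding strictly_finer_def
    using hausdorff_open_inner_radius[where 'a = 'a, of 2] wasserstein_not_open_inner_radius[OF assms(2), where 'a = 'a]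
    by blast
qed

end
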